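(* Let $r\ge 3$ and $k\ge 1$ be integers and let $G$ be a finite simple graph that is $K_{1,r}$-free. Then $\iota'_k(G)\le (r-2)(\iota_k(G)-1)+1$.
   Context: $G$ is $K_{1,r}$-free if it contains no induced subgraph isomorphic to the star $K_{1,r}$. For $S\subseteq V(G)$, $N_G[S]$ is the closed neighborhood of $S$. $K_k$ is the complete graph on $k$ vertices. A set $S\subseteq V(G)$ is $K_k$-isolating if $G-N_G[S]$ contains no subgraph isomorphic to $K_k$; $\iota_k(G)$ is the minimum cardinality of a $K_k$-isolating set. A set is independent $K_k$-isolating if it is $K_k$-isolating and induces no edge; $\iota'_k(G)$ is the minimum cardinality of an independent $K_k$-isolating set.
   Formalization: The formal theorem also assumes that r = 3 or ι_k(G) ≥ 1; when r ≥ 4 and ι_k(G) = 0 (G contains no K_k) the stated bound is 3 − r < 0 = ι'_k(G), so the claim is false there. *)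

theory Defs
  imports "Graph_Theory.Graph_Theory"
begin

text \<open>
  A finite simple graph is modelled by the locale \<^locale>\<open>graph\<close>: a finite, loop-free, symmetric
  digraph without parallel arcs, in which an edge \<open>uv\<close> is the pair of opposite arcs
  \<open>u \<rightarrow> v\<close> and \<open>v \<rightarrow> u\<close>. The predicates \<^const>\<open>complete_digraph\<close> and
  \<^const>\<open>complete_bipartite_digraph\<close> hold of all graphs of the respective isomorphism type,
  so that no explicit isomorphism is needed below.
\<close>

definition star_free :: "nat \<Rightarrow> ('a, 'b) pre_digraph \<Rightarrow> bool" where
  "star_free r G \<longleftrightarrow> \<not> (\<exists>H. induced_subgraph H G \<and> complete_bipartite_digraph 1 r H)"

definition closed_nbhd :: "('a, 'b) pre_digraph \<Rightarrow> 'a set \<Rightarrow> 'a set" where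
  "closed_nbhd G S = S \<union> {v \<in> verts G. \<exists>u\<in>S. u \<rightarrow>\<^bsub>G\<^esub> v}"

definition isolating :: "nat \<Rightarrow> ('a, 'b) pre_digraph \<Rightarrow> 'a set \<Rightarrow> bool" where
  "isolating k G S \<longleftrightarrow> S \<subseteq> verts G \<and>
     \<not> (\<exists>H. subgraph H (G \<restriction> (verts G - closed_nbhd G S)) \<and> complete_digraph k H)"

definition independent :: "('a, 'b) pre_digraph \<Rightarrow> 'a set \<Rightarrow> bool" where
  "independent G S \<longleftrightarrow> arcs (G \<restriction> S) = {}"

text \<open>
  For \<open>k \<ge> 1\<close> both minima below are attained: in a finite graph a maximal independent set
  dominates every vertex, hence is independent and isolating.
\<close>

definition isolation_number :: "nat \<Rightarrow> ('a, 'b) pre_digraph \<Rightarrow> nat" where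
  "isolation_number k G = Min (card ` {S. isolating k G S})"

definition independent_isolation_number :: "nat \<Rightarrow> ('a, 'b) pre_digraph \<Rightarrow> nat" where
  "independent_isolation_number k G = Min (card ` {S. isolating k G S \<and> independent G S})"

text \<open>
  If \<open>G\<close> has no \<open>K\<^sub>k\<close>, both numbers are \<open>0\<close>, and the integer bound
  \<open>(r - 2) (\<iota>\<^sub>k(G) - 1) + 1\<close> equals \<open>3 - r\<close>. It is then violated exactly for \<open>r \<ge> 4\<close>,
  which is why the bound needs \<open>r = 3\<close> or \<open>\<iota>\<^sub>k(G) \<ge> 1\<close>.
\<close>

end

theory Submission
  imports Defs
begin

text \<open>
  Let \<open>D\<close> be a minimum isolating set, \<open>I\<close> a maximal independent subset of \<open>D\<close>, and \<open>S\<close> a maximal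
  independent subset of \<open>N[D]\<close> containing \<open>I\<close>. Then \<open>N[D] \<subseteq> N[S]\<close>, so \<open>S\<close> is isolating. Every vertex
  of \<open>S - I\<close> has a neighbour in \<open>D - I\<close>, while every vertex of \<open>D - I\<close> has at most \<open>r - 1\<close> neighbours
  in \<open>S\<close>, one of which lies in \<open>I\<close>. Hence \<open>|S| \<le> |I| + (r - 2) (|D| - |I|)\<close>, and \<open>|I| \<ge> 1\<close> unless
  \<open>D\<close> is empty.
\<close>

lemma independent_iff: "independent G S \<longleftrightarrow> (\<forall>u\<in>S. \<forall>v\<in>S. \<not> u \<rightarrow>\<^bsub>G\<^esub> v)"
  unfolding independent_def by (auto simp: arcs_ends_conv)

lemma independent_subset: "independent G S \<Longrightarrow> T \<subseteq> S \<Longrightarrow> independent G T"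
  unfolding independent_iff by blast

context graph
begin

lemma dominates_sym: "u \<rightarrow> v \<Longrightarrow> v \<rightarrow> u"
  using sym_arcs by (rule arcs_ends_symmetric)

lemma dominates_verts: "u \<rightarrow> v \<Longrightarrow> u \<in> verts G \<and> v \<in> verts G"
  by (auto simp: arcs_ends_conv)

lemma closed_nbhd_subset_verts: "S \<subseteq> verts G \<Longrightarrow> closed_nbhd G S \<subseteq> verts G"
  unfolding closed_nbhd_def by blast

text \<open>A vertex of \<open>A\<close> outside the closed neighbourhood of a maximal
  \<open>S\<close> could be added to \<open>S\<close>. Used for \<open>A = D\<close> starting from
  the empty set, and then for \<open>A = closed_nbhd G D\<close> starting from
  \<open>I\<close>.\<close>

lemma maximal_independent_extension:
  assumes "A \<subseteq> verts G" "I \<subseteq> A" "independent G I"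
  obtains S where "I \<subseteq> S" "S \<subseteq> A" "independent G S" "A \<subseteq> closed_nbhd G S"
proof -
  let ?F = "{S. S \<subseteq> A \<and> independent G S}"
  have "finite ?F"
    using assms(1) by (intro finite_subset[of ?F "Pow (verts G)"]) auto
  moreover have "I \<in> ?F"
    using assms by simp
  ultimately have "\<exists>S\<in>?F. I \<subseteq> S \<and> (\<forall>T\<in>?F. S \<subseteq> T \<longrightarrow> S = T)"
    by (rule finite_has_maximal2)
  then obtain S where S: "S \<subseteq> A" "independent G S" "I \<subseteq> S"
    and max: "\<And>T. T \<subseteq> A \<Longrightarrow> independent G T \<Longrightarrow> S \<subseteq> T \<Longrightarrow> S = T"
    by auto
  have "x \<in> closed_nbhd G S" if "x \<in> A" for x
  proof (rule ccontr)
    assume x: "x \<notin> closed_nbhd G S"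
    have "x \<in> verts G"
      using assms(1) \<open>x \<in> A\<close> by (rule subsetD)
    \<comment> \<open>\<open>closed_nbhd\<close> excludes only arcs from \<open>S\<close> to
      \<open>x\<close>; symmetry excludes the reverse arcs, and loop-freeness the arc at
      \<open>x\<close>.\<close>
    with x have from_S: "\<not> u \<rightarrow> x" if "u \<in> S" for u
      using that unfolding closed_nbhd_def by auto
    moreover have "\<not> x \<rightarrow> u" if "u \<in> S" for u
      using from_S[OF that] dominates_sym by metis
    moreover have "\<not> x \<rightarrow> x"
      using adj_not_same by metis
    ultimately have "x \<notin> S" "independent G (insert x S)"
      using S(2) x unfolding independent_iff closed_nbhd_def by auto
    then show False
      using max[of "insert x S"] S(1) \<open>x \<in> A\<close> by auto
  qed
  with S that show thesis by blast
qed

text \<open>Any \<open>r\<close> of the vertices in \<open>T\<close> would induce, together with the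
  centre \<open>v\<close>, a star with \<open>r\<close> leaves.\<close>

lemma star_free_independent_nbrs:
  assumes "star_free r G" "v \<in> verts G" "T \<subseteq> {w. v \<rightarrow> w}" "independent G T"
  shows "card T < r"
proof (rule ccontr)
  assume "\<not> card T < r"
  then obtain U where U: "U \<subseteq> T" "card U = r"
    by (meson not_less obtain_subset_with_card_n)
  let ?H = "G \<restriction> insert v U"
  have vU: "v \<notin> U" "insert v U \<subseteq> verts G"
    using assms(2,3) U(1) adj_not_same dominates_verts by blast+
  have ind: "induced_subgraph ?H G"
    using vU(2) by (rule induced_induce)
  then have "digraph ?H" "symmetric ?H"
    using digraph_subgraph induced_graph_imp_symmetric[OF sym_arcs] by auto
  then have "graph ?H"
    by (rule digraph.graphI)
  moreover
  have edges: "v \<rightarrow> u" "u \<rightarrow> v" if "u \<in> U" for u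
    using that assms(3) U(1) dominates_sym by blast+
  have no_edges: "\<not> u \<rightarrow> w" if "u \<in> U" "w \<in> U" for u w
    using that U(1) assms(4) unfolding independent_iff by blast
  have loop: "\<not> v \<rightarrow> v"
    using adj_not_same by metis
  have "arcs_ends ?H = arcs_ends G \<inter> insert v U \<times> insert v U"
    by (auto simp: arcs_ends_conv)
  then have "arcs_ends ?H = {v} \<times> U \<union> U \<times> {v}"
    using edges no_edges loop by auto
  moreover have "verts ?H = {v} \<union> U" "{v} \<inter> U = {}" "card {v} = 1"
    using vU(1) by auto
  ultimately have "complete_bipartite_digraph 1 r ?H"
    using U(2) unfolding complete_bipartite_digraph_def by (intro conjI exI[of _ "{v}"] exI[of _ U])
  with ind assms(1) show False
    unfolding star_free_def by blast
qed

text \<open>Enlarging the closed neighbourhood shrinks the remaining graph, so no new complete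
  subgraph can appear there.\<close>

lemma isolating_mono:
  assumes "isolating k G D" "S \<subseteq> verts G" "closed_nbhd G D \<subseteq> closed_nbhd G S"
  shows "isolating k G S"
proof -
  have "subgraph (G \<restriction> (verts G - closed_nbhd G S)) (G \<restriction> (verts G - closed_nbhd G D))"
    using assms(3) by (intro subgraphI wellformed_induce_subgraph) (auto simp: compatible_def)
  with assms show ?thesis
    unfolding isolating_def by (meson subgraph_trans)
qed

lemma finite_isolating: "finite {S. isolating k G S}"
  by (rule finite_subset[of _ "Pow (verts G)"]) (auto simp: isolating_def)

text \<open>This makes the set under \<open>Min\<close> nonempty, so that the minimum is attained.
  Nothing remains after removing all vertices, and the empty graph is complete on \<open>k\<close>
  vertices only for \<open>k = 0\<close>.\<close>

lemma isolating_verts: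
  assumes "k \<ge> 1"
  shows "isolating k G (verts G)"
proof -
  have "verts G - closed_nbhd G (verts G) = {}"
    unfolding closed_nbhd_def by blast
  then show ?thesis
    using assms unfolding isolating_def complete_digraph_def subgraph_def
    by (metis card.empty induce_subgraph_verts not_one_le_zero order_refl subset_empty)
qed

lemma obtain_minimum_isolating:
  assumes "k \<ge> 1"
  obtains D where "isolating k G D" "card D = isolation_number k G"
proof -
  have "isolation_number k G \<in> card ` {S. isolating k G S}"
    unfolding isolation_number_def
    using finite_isolating isolating_verts[OF assms] by (intro Min_in) auto
  then show thesis
    using that by auto
qed

lemma independent_isolation_number_le:
  assumes "isolating k G S" "independent G S"
  shows "independent_isolation_number k G \<le> card S"
  unfolding independent_isolation_number_def
proof (rule Min_le)
  show "finite (card ` {S. isolating k G S \<and> independent G S})"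
    using finite_isolating by (rule finite_imageI[OF finite_subset, rotated]) auto
qed (use assms in auto)

text \<open>\<open>I\<close> stays visible because the bound weakens as \<open>I\<close> shrinks:
  for \<open>r \<ge> 3\<close> its worst case is the smallest possible \<open>I\<close>, which is
  nonempty unless \<open>D\<close> is empty.\<close>

lemma independent_isolating_from_isolating:
  assumes "star_free r G" "isolating k G D"
  obtains S I where "isolating k G S" "independent G S" "I \<subseteq> D" "I = {} \<longrightarrow> D = {}"
    "card S \<le> card I + (r - 2) * card (D - I)"
proof -
  have D: "D \<subseteq> verts G" and fin: "finite D"
    using assms(2) finite_subset[OF _ finite_verts] unfolding isolating_def by auto
  obtain I where I: "I \<subseteq> D" "independent G I" "D \<subseteq> closed_nbhd G I"
    using maximal_independent_extension[OF D, of "{}"] by (auto simp: independent_iff)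
  have "I \<subseteq> closed_nbhd G D"
    using I(1) unfolding closed_nbhd_def by blast
  then obtain S where S: "I \<subseteq> S" "S \<subseteq> closed_nbhd G D" "independent G S"
    "closed_nbhd G D \<subseteq> closed_nbhd G S"
    using maximal_independent_extension[OF closed_nbhd_subset_verts[OF D]] I(2) by metis
  have SV: "S \<subseteq> verts G" and finS: "finite S"
    using S(2) closed_nbhd_subset_verts[OF D] finite_subset[OF _ finite_verts] by auto
  \<comment> \<open>As \<open>S\<close> is independent and contains \<open>I\<close>, a vertex
    \<open>w\<close> of \<open>S - I\<close> is not adjacent to \<open>I\<close>. Since
    \<open>I\<close> dominates \<open>D\<close>, \<open>w\<close> lies outside \<open>D\<close>, so
    its membership in \<open>closed_nbhd G D\<close> comes from a neighbour in \<open>D\<close>, and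
    that neighbour is not in \<open>I\<close>.\<close>
  have "S - I \<subseteq> (\<Union>d\<in>D - I. {w \<in> S - I. d \<rightarrow> w})"
  proof
    fix w assume w: "w \<in> S - I"
    then have "\<not> i \<rightarrow> w" if "i \<in> I" for i
      using S(1,3) that unfolding independent_iff by blast
    moreover from this w have "w \<notin> D"
      using I(3) unfolding closed_nbhd_def by blast
    ultimately show "w \<in> (\<Union>d\<in>D - I. {w \<in> S - I. d \<rightarrow> w})"
      using w S(2) unfolding closed_nbhd_def by blast
  qed
  then have "card (S - I) \<le> card (\<Union>d\<in>D - I. {w \<in> S - I. d \<rightarrow> w})"
    using fin finS by (intro card_mono) auto
  also have "\<dots> \<le> (\<Sum>d\<in>D - I. card {w \<in> S - I. d \<rightarrow> w})"
    using fin by (intro card_UN_le) auto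
  also have "\<dots> \<le> (\<Sum>d\<in>D - I. r - 2)"
  proof (rule sum_mono)
    fix d assume d: "d \<in> D - I"
    then obtain i where i: "i \<in> I" "d \<rightarrow> i"
      using I(3) dominates_sym unfolding closed_nbhd_def by blast
    let ?T = "{w \<in> S - I. d \<rightarrow> w}"
    \<comment> \<open>Adding \<open>i\<close>, a neighbour of \<open>d\<close> in \<open>I\<close>
      and hence outside \<open>?T\<close>, improves the bound from \<open>r - 1\<close> to
      \<open>r - 2\<close>.\<close>
    have "independent G (insert i ?T)"
      using S(1,3) i(1) by (intro independent_subset[OF S(3)]) auto
    then have "card (insert i ?T) < r"
      using i(2) d D by (intro star_free_independent_nbrs[OF assms(1), of d]) auto
    then show "card ?T \<le> r - 2"
      using i(1) finS by simp
  qed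
  also have "\<dots> = (r - 2) * card (D - I)"
    by simp
  finally have "card S \<le> card I + (r - 2) * card (D - I)"
    using card_Diff_subset[of I S] S(1) finS finite_subset[OF S(1) finS] card_mono[OF finS S(1)] by linarith
  moreover have "I = {} \<longrightarrow> D = {}"
    using I(3) unfolding closed_nbhd_def by auto
  ultimately show thesis
    using that isolating_mono[OF assms(2) SV S(4)] S(3) I(1) by blast
qed

end

theorem theorem4:
  fixes G :: "('a, 'b) pre_digraph" and r k :: nat
  assumes "r \<ge> 3" and "k \<ge> 1"
    and "graph G"
    and "star_free r G"
    and "r = 3 \<or> isolation_number k G \<ge> 1"
  shows "int (independent_isolation_number k G)
           \<le> (int r - 2) * (int (isolation_number k G) - 1) + 1"
proof -
  interpret graph G by fact
  obtain D where D: "isolating k G D" "card D = isolation_number k G"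
    using obtain_minimum_isolating[OF \<open>k \<ge> 1\<close>] by blast
  obtain S I where S: "isolating k G S" "independent G S"
    and I: "I \<subseteq> D" "I = {} \<longrightarrow> D = {}"
    and le: "card S \<le> card I + (r - 2) * card (D - I)"
    using independent_isolating_from_isolating[OF \<open>star_free r G\<close> D(1)] by metis
  have fin: "finite D" "finite I"
    using D(1) I(1) finite_subset finite_verts unfolding isolating_def by metis+
  have "int (card (D - I)) = int (card D) - int (card I)"
    using fin I(1) by (simp add: card_Diff_subset card_mono of_nat_diff)
  \<comment> \<open>Since \<open>r \<ge> 3\<close>, the truncated subtraction \<open>r - 2\<close>
    agrees with the integer one.\<close>
  then have "int (card S) \<le> int (card I) + (int r - 2) * (int (card D) - int (card I))"
    using of_nat_mono[OF le, where 'a = int] \<open>r \<ge> 3\<close> by (simp add: of_nat_diff)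
  \<comment> \<open>The target bound is split off, leaving a product that only has to be
    nonnegative.\<close>
  also have "\<dots> = (int r - 2) * (int (card D) - 1) + 1 - (int r - 3) * (int (card I) - 1)"
    by (simp add: algebra_simps)
  also have "\<dots> \<le> (int r - 2) * (int (card D) - 1) + 1"
  proof -
    \<comment> \<open>For \<open>r = 3\<close> the product vanishes; otherwise \<open>D\<close> is
      nonempty, hence so is \<open>I\<close>, and both factors are nonnegative.\<close>
    have "r = 3 \<or> card I \<ge> 1"
      using assms(5) D(2) I(2) fin by (cases "I = {}") (auto simp: Suc_le_eq card_gt_0_iff)
    then have "(int r - 3) * (int (card I) - 1) \<ge> 0"
      using \<open>r \<ge> 3\<close> by auto
    then show ?thesis
      by linarith
  qed
  finally show ?thesis
    using independent_isolation_number_le[OF S] D(2) by simp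
qed

end
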